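(* Let $G$ be a finite group, $k$ a field, and let $a:G^2\to k$ satisfy $$a(x,y)+a(x\triangleleft y,z)-a(x,yz)=0\qquad\text{for all }x,y,z\in G.$$ Let $\psi(x,y)=a(x,y)$. Then $\psi$ satisfies the rack $2$-cocycle condition $$\psi(x,y)+\psi(x\triangleleft y,z)=\psi(x,z)+\psi(x\triangleleft z,y\triangleleft z)\qquad\text{for all }x,y,z\in G.$$
   Context: For $x,y$ in a group $G$, $x\triangleleft y:=y^{-1}xy$. Functions $a$ as in the hypothesis are exactly the "adjoint $2$-cocycle coefficients" on the group algebra $kG$. *)

theory Defs
  imports "HOL-Algebra.Ring"
begin

definition conj_op :: "('g, 'm) monoid_scheme \<Rightarrow> 'g \<Rightarrow> 'g \<Rightarrow> 'g" where
  "conj_op G x y = inv\<^bsub>G\<^esub> y \<otimes>\<^bsub>G\<^esub> x \<otimes>\<^bsub>G\<^esub> y"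

text \<open>These functions are exactly the coefficients of the adjoint 2-cocycles on the group algebra \<open>K G\<close>.\<close>

definition adjoint_2cocycle_coeff ::
    "('g, 'm) monoid_scheme \<Rightarrow> ('k, 'n) ring_scheme \<Rightarrow> ('g \<Rightarrow> 'g \<Rightarrow> 'k) \<Rightarrow> bool" where
  "adjoint_2cocycle_coeff G K a \<longleftrightarrow>
     a \<in> carrier G \<rightarrow> carrier G \<rightarrow> carrier K \<and>
     (\<forall>x\<in>carrier G. \<forall>y\<in>carrier G. \<forall>z\<in>carrier G.
        (a x y \<oplus>\<^bsub>K\<^esub> a (conj_op G x y) z) \<ominus>\<^bsub>K\<^esub> a x (y \<otimes>\<^bsub>G\<^esub> z) = \<zero>\<^bsub>K\<^esub>)"

text \<open>The rack 2-cocycle condition for a function on a set \<open>X\<close> with rack operation \<open>r\<close>,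
  with values in the additive group of \<open>K\<close>.\<close>

definition rack_2cocycle ::
    "'g set \<Rightarrow> ('g \<Rightarrow> 'g \<Rightarrow> 'g) \<Rightarrow> ('k, 'n) ring_scheme \<Rightarrow> ('g \<Rightarrow> 'g \<Rightarrow> 'k) \<Rightarrow> bool" where
  "rack_2cocycle X r K \<psi> \<longleftrightarrow>
     \<psi> \<in> X \<rightarrow> X \<rightarrow> carrier K \<and>
     (\<forall>x\<in>X. \<forall>y\<in>X. \<forall>z\<in>X.
        \<psi> x y \<oplus>\<^bsub>K\<^esub> \<psi> (r x y) z = \<psi> x z \<oplus>\<^bsub>K\<^esub> \<psi> (r x z) (r y z))"

end

theory Submission
  imports Defs
begin

text \<open>Since \<open>y z = z (y \<triangleleft> z)\<close>, evaluating \<open>a(x, y z)\<close> by the cocycle identity for both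
  factorisations yields the two sides of the rack condition.\<close>

lemma (in group) conj_op_closed [simp, intro]:
  "x \<in> carrier G \<Longrightarrow> y \<in> carrier G \<Longrightarrow> conj_op G x y \<in> carrier G"
  by (simp add: conj_op_def)

lemma (in group) mult_conj_op:
  "y \<in> carrier G \<Longrightarrow> z \<in> carrier G \<Longrightarrow> z \<otimes> conj_op G y z = y \<otimes> z"
  \<comment> \<open>The reversed instance regroups \<open>z\<close> with \<open>inv z\<close> so
    that they cancel; \<open>m_assoc\<close> alone nests products to the right.\<close>
  by (simp add: conj_op_def m_assoc flip: m_assoc[of z "inv z"])

lemma adjoint_2cocycle_coeff_closed:
  assumes "adjoint_2cocycle_coeff G K a" "x \<in> carrier G" "y \<in> carrier G"
  shows "a x y \<in> carrier K"
  using assms unfolding adjoint_2cocycle_coeff_def by (blast dest: funcset_mem)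

text \<open>Oriented this way, the cocycle identity is a rewrite rule that merges a two-term sum
  into a single value of \<open>a\<close>.\<close>

lemma adjoint_2cocycle_coeff_mult:
  assumes "group G" and "abelian_group K" and coc: "adjoint_2cocycle_coeff G K a"
    and xyz: "x \<in> carrier G" "y \<in> carrier G" "z \<in> carrier G"
  shows "a x y \<oplus>\<^bsub>K\<^esub> a (conj_op G x y) z = a x (y \<otimes>\<^bsub>G\<^esub> z)"
proof -
  interpret G: group G by fact
  interpret K: abelian_group K by fact
  have "(a x y \<oplus>\<^bsub>K\<^esub> a (conj_op G x y) z) \<ominus>\<^bsub>K\<^esub> a x (y \<otimes>\<^bsub>G\<^esub> z) = \<zero>\<^bsub>K\<^esub>"
    using coc xyz by (simp add: adjoint_2cocycle_coeff_def)
  then show ?thesis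
    \<comment> \<open>The sum and the negative of the value at \<open>y z\<close> add up to zero, so
      by uniqueness of additive inverses the sum is the negative of that negative.\<close>
    using xyz K.minus_equality[of "a x y \<oplus>\<^bsub>K\<^esub> a (conj_op G x y) z" "\<ominus>\<^bsub>K\<^esub> a x (y \<otimes>\<^bsub>G\<^esub> z)"]
    by (simp add: a_minus_def adjoint_2cocycle_coeff_closed[OF coc])
qed

theorem proposition6p3:
  fixes G :: "('g, 'm) monoid_scheme"
    and K :: "('k, 'n) ring_scheme"
    and a \<psi> :: "'g \<Rightarrow> 'g \<Rightarrow> 'k"
  assumes "group G"
    and "finite (carrier G)"
    and "field K"
    and "adjoint_2cocycle_coeff G K a"
    and "\<And>x y. x \<in> carrier G \<Longrightarrow> y \<in> carrier G \<Longrightarrow> \<psi> x y = a x y"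
  shows "rack_2cocycle (carrier G) (conj_op G) K \<psi>"
proof -
  interpret G: group G by fact
  interpret K: field K by fact
  note mult = adjoint_2cocycle_coeff_mult[OF G.is_group K.abelian_group_axioms assms(4)]
  have "\<psi> \<in> carrier G \<rightarrow> carrier G \<rightarrow> carrier K"
    using assms(5) by (simp add: adjoint_2cocycle_coeff_closed[OF assms(4)])
  then show ?thesis
    \<comment> \<open>Conjugates stay in the carrier, so \<open>\<psi>\<close> can be replaced by
      \<open>a\<close> throughout. Then \<open>mult\<close> collapses each side to one value of
      \<open>a x\<close>, and \<open>mult_conj_op\<close> identifies the two second
      arguments.\<close>
    by (simp add: rack_2cocycle_def assms(5) mult G.mult_conj_op)
qed

end
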